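(* Let $b\ge 2$ be an integer and let $(s_b(n))_{n\ge 0}$ be the base $b$ Stern sequence. For an integer $N\ge 0$ let $l_N:=\frac{b^{N+1}-1}{b-1}$. Then $$(b+1)^N=\sum_{n=l_N-b^N+1}^{l_N}s_b(n).$$
   Context: For an integer $b\ge 2$, the base $b$ Stern sequence $s_b(n)$ is defined by $s_b(0)=0$, $s_b(1)=1$, and for $n\ge 1$ by $$s_b(b(n-1)+j+1)=s_b(n)\quad(1\le j\le b-1),\qquad s_b(bn+1)=s_b(n)+s_b(n+1).$$ (Equivalently, $s_b(n+1)$ is the number of hyper $b$-ary expansions of $n$, i.e. the number of partitions of $n$ into parts from $\{1,b,b^2,\ldots\}$ with each part used at most $b$ times.) *)

theory Defs
  imports Main
begin

text \<open>
  The recursion is solved for its argument: \<open>b (n - 1) + j + 1\<close> with \<open>1 \<le> j \<le> b - 1\<close>,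
  and \<open>b n + 1\<close>, for \<open>n \<ge> 1\<close>, are precisely the numbers \<open>m \<ge> 2\<close> with \<open>\<not> b dvd m - 1\<close>
  and \<open>b dvd m - 1\<close>, respectively.  The defining equations of the sequence are derived in
  \<open>stern_digit\<close> and \<open>stern_carry\<close>, and \<open>stern_unique\<close> shows that they determine it.
  For \<open>b < 2\<close> the function carries no meaning.
\<close>

function stern :: "nat \<Rightarrow> nat \<Rightarrow> nat" where
  "stern b m =
    (if b < 2 \<or> m = 0 then 0
     else if m = 1 then 1
     else if b dvd m - 1 then stern b ((m - 1) div b) + stern b ((m - 1) div b + 1)
     else stern b ((m - 1) div b + 1))"
  by pat_completeness auto

lemma stern_arg_less:
  fixes b m :: nat
  assumes "2 \<le> b" "2 \<le> m"
  shows "(m - 1) div b + 1 < m"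
proof -
  have "(m - 1) div b < m - 1"
    using assms by (intro div_less_dividend) auto
  then show ?thesis by simp
qed

termination
proof (relation "measure snd", goal_cases)
  case 1
  then show ?case by simp
next
  case (2 b m)
  then show ?case using stern_arg_less[of b m] by auto
next
  case (3 b m)
  then show ?case using stern_arg_less[of b m] by auto
next
  case (4 b m)
  then show ?case using stern_arg_less[of b m] by auto
qed

declare stern.simps [simp del]

lemma stern_0: "stern b 0 = 0"
  by (simp add: stern.simps)

lemma stern_1: "2 \<le> b \<Longrightarrow> stern b 1 = 1"
  by (simp add: stern.simps)

lemma stern_digit:
  assumes "2 \<le> b" "1 \<le> n" "1 \<le> j" "j \<le> b - 1"
  shows "stern b (b * (n - 1) + j + 1) = stern b n"
proof -
  have jb: "0 < j" "j < b" using assms by auto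
  have d: "(b * (n - 1) + j) div b = n - 1"
    using jb by simp
  have "(b * (n - 1) + j) mod b = j"
    using jb by simp
  then have nd: "\<not> b dvd b * (n - 1) + j"
    using jb by (auto simp: dvd_eq_mod_eq_0)
  show ?thesis
    using assms nd d by (subst stern.simps) auto
qed

lemma stern_carry:
  assumes "2 \<le> b" "1 \<le> n"
  shows "stern b (b * n + 1) = stern b n + stern b (n + 1)"
  using assms by (subst stern.simps) auto

lemma stern_unique:
  fixes s :: "nat \<Rightarrow> nat"
  assumes b: "2 \<le> b"
    and s0: "s 0 = 0" and s1: "s 1 = 1"
    and digit: "\<And>n j. 1 \<le> n \<Longrightarrow> 1 \<le> j \<Longrightarrow> j \<le> b - 1 \<Longrightarrow> s (b * (n - 1) + j + 1) = s n"
    and carry: "\<And>n. 1 \<le> n \<Longrightarrow> s (b * n + 1) = s n + s (n + 1)"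
  shows "s = stern b"
proof
  fix m
  show "s m = stern b m"
  proof (induction m rule: less_induct)
    case (less m)
    consider "m = 0" | "m = 1" | "2 \<le> m" by linarith
    then show ?case
    proof cases
      case 1
      then show ?thesis using s0 stern_0 by simp
    next
      case 2
      then show ?thesis using s1 stern_1[OF b] by simp
    next
      case 3
      define n where "n = (m - 1) div b"
      have lt: "n + 1 < m" using stern_arg_less[OF b 3] by (simp add: n_def)
      have eq: "b * n + (m - 1) mod b = m - 1"
        unfolding n_def by simp
      show ?thesis
      proof (cases "(m - 1) mod b = 0")
        case True
        then have m: "m = b * n + 1" using eq 3 by simp
        then have "1 \<le> n" using 3 by (cases n) auto
        then show ?thesis
          using carry stern_carry[OF b] less.IH[of n] less.IH[of "n + 1"] lt m by simp
      next
        case False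
        define j where "j = (m - 1) mod b"
        have j: "1 \<le> j" "j \<le> b - 1"
          using False b mod_less_divisor[of b "m - 1"] unfolding j_def by linarith+
        have m: "m = b * (n + 1 - 1) + j + 1" using eq 3 by (simp add: j_def)
        have "s m = s (n + 1)" using digit[of "n + 1" j] j m by simp
        moreover have "stern b m = stern b (n + 1)"
          using stern_digit[OF b, of "n + 1" j] j m by simp
        ultimately show ?thesis using less.IH[OF lt] by simp
      qed
    qed
  qed
qed

definition stern_l :: "nat \<Rightarrow> nat \<Rightarrow> nat" where
  "stern_l b N = (b ^ (N + 1) - 1) div (b - 1)"

text \<open>
  The division in \<open>stern_l\<close> is exact, and \<open>stern_l b N - b ^ N\<close> is not truncated.
\<close>

lemma stern_l_exact:
  assumes "2 \<le> b"
  shows "(b - 1) * stern_l b N = b ^ (N + 1) - 1"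
proof -
  have "int (b - 1) dvd int (b ^ (N + 1) - 1)"
  proof -
    have "int b - 1 dvd int b ^ (N + 1) - 1 ^ (N + 1)"
      by (simp only: power_diff_sumr2 dvd_triv_left)
    then show ?thesis
      using assms by (simp add: of_nat_diff)
  qed
  then have "b - 1 dvd b ^ (N + 1) - 1"
    by (simp only: of_nat_dvd_iff)
  then show ?thesis
    unfolding stern_l_def by simp
qed

lemma power_le_stern_l:
  assumes "2 \<le> b"
  shows "b ^ N \<le> stern_l b N"
proof -
  have "b ^ N * (b - 1) \<le> b ^ (N + 1) - 1"
    using assms by (simp add: diff_mult_distrib2 mult.commute diff_le_mono2)
  then show ?thesis
    unfolding stern_l_def using assms by (simp add: less_eq_div_iff_mult_less_eq)
qed

end

theory Submission
  imports Defs
begin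

text \<open>
  Since \<open>l\<^sub>N - b\<^sup>N = l\<^sub>N\<^sub>-\<^sub>1\<close>, the sum runs over the half-open interval
  \<open>(l\<^sub>N\<^sub>-\<^sub>1, l\<^sub>N]\<close>, where \<open>l\<^sub>-\<^sub>1 = 0\<close>.  The map \<open>k \<mapsto> b * k + 1\<close> sends \<open>l\<^sub>N\<^sub>-\<^sub>1\<close>
  to \<open>l\<^sub>N\<close>, so it carries the endpoints of each interval to those of the next one and
  splits the next interval into blocks \<open>(b * (k - 1) + 1, b * k + 1]\<close>, one for each \<open>k\<close> in
  the old interval.  By the recursion, a block contains \<open>b - 1\<close> copies of \<open>s(k)\<close> and one term
  \<open>s(k) + s(k + 1)\<close>, that is, \<open>b * s(k) + s(k + 1)\<close> in total (\<open>sum_stern_block\<close>).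

  Summed over the blocks, this is \<open>b + 1\<close> times the old sum, up to a boundary term
  \<open>s(l\<^sub>N + 1) - s(l\<^sub>N\<^sub>-\<^sub>1 + 1)\<close> from the shifted copy (\<open>sum_stern_stretch\<close>).  That term
  vanishes, because \<open>l\<^sub>N + 1 = b * l\<^sub>N\<^sub>-\<^sub>1 + 2\<close> is the first index in the block of
  \<open>l\<^sub>N\<^sub>-\<^sub>1 + 1\<close>, hence one of its copies.  So every step multiplies the sum by \<open>b + 1\<close>, starting from \<open>s(1) = 1\<close>.
\<close>

lemma sum_stern_block:
  assumes "2 \<le> b"
  shows "(\<Sum>n\<in>{b * k + 1<..b * Suc k + 1}. stern b n) = b * stern b (k + 1) + stern b (k + 2)"
proof -
  have "{b * k + 1<..b * Suc k + 1} = insert (b * Suc k + 1) ((\<lambda>j. b * k + j + 1) ` {1..b - 1})"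
  proof (intro equalityI subsetI)
    fix n assume "n \<in> {b * k + 1<..b * Suc k + 1}"
    then have "n = b * Suc k + 1 \<or> n - (b * k + 1) \<in> {1..b - 1} \<and> n = b * k + (n - (b * k + 1)) + 1"
      by auto
    then show "n \<in> insert (b * Suc k + 1) ((\<lambda>j. b * k + j + 1) ` {1..b - 1})"
      by blast
  qed (use assms in auto)
  moreover have "b * Suc k + 1 \<notin> (\<lambda>j. b * k + j + 1) ` {1..b - 1}"
    using assms by auto
  moreover have "inj_on (\<lambda>j. b * k + j + 1) {1..b - 1}"
    by (auto simp: inj_on_def)
  ultimately have "(\<Sum>n\<in>{b * k + 1<..b * Suc k + 1}. stern b n)
      = stern b (b * Suc k + 1) + (\<Sum>j\<in>{1..b - 1}. stern b (b * k + j + 1))"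
    by (simp add: sum.reindex)
  also have "(\<Sum>j\<in>{1..b - 1}. stern b (b * k + j + 1)) = (\<Sum>j\<in>{1..b - 1}. stern b (k + 1))"
    using stern_digit[OF assms, of "k + 1"] by (intro sum.cong) auto
  also have "stern b (b * Suc k + 1) = stern b (k + 1) + stern b (k + 2)"
    using stern_carry[OF assms, of "Suc k"] by simp
  also have "stern b (k + 1) + stern b (k + 2) + (\<Sum>j\<in>{1..b - 1}. stern b (k + 1))
      = Suc (b - 1) * stern b (k + 1) + stern b (k + 2)"
    by simp
  finally show ?thesis
    using assms by simp
qed

text \<open>
  The terms \<open>s(k + 1)\<close> of the blocks form the sum over the interval shifted by one; the summands
  \<open>s(p + 1)\<close> and \<open>s(q + 1)\<close> are the two ends of this shift.
\<close>

lemma sum_stern_stretch: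
  assumes "2 \<le> b" "p \<le> q"
  shows "(\<Sum>n\<in>{b * p + 1<..b * q + 1}. stern b n) + stern b (p + 1)
    = (b + 1) * (\<Sum>n\<in>{p<..q}. stern b n) + stern b (q + 1)"
  using assms(2)
proof (induction q rule: dec_induct)
  case base
  then show ?case by simp
next
  case (step q)
  have "{b * p + 1<..b * Suc q + 1} = {b * p + 1<..b * q + 1} \<union> {b * q + 1<..b * Suc q + 1}"
    using step.hyps by (intro ivl_disj_un_two(6)[symmetric]) auto
  then have "(\<Sum>n\<in>{b * p + 1<..b * Suc q + 1}. stern b n)
      = (\<Sum>n\<in>{b * p + 1<..b * q + 1}. stern b n) + (b * stern b (q + 1) + stern b (q + 2))"
    using sum_stern_block[OF assms(1), of q] by (simp add: sum.union_disjoint ivl_disj_int_two(6))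
  moreover have "{p<..Suc q} = insert (Suc q) {p<..q}"
    using step.hyps by auto
  ultimately show ?case
    using step.IH by (simp add: algebra_simps)
qed

lemma stern_l_0:
  assumes "2 \<le> b"
  shows "stern_l b 0 = 1"
  using assms by (simp add: stern_l_def)

lemma stern_l_Suc:
  assumes "2 \<le> b"
  shows "stern_l b (Suc N) = stern_l b N + b ^ Suc N"
proof -
  have "0 < b ^ (N + 1)"
    using assms by simp
  moreover have "b ^ (Suc N + 1) = (b - 1) * b ^ (N + 1) + b ^ (N + 1)"
    using assms by (cases b) auto
  ultimately have "(b - 1) * stern_l b (Suc N) = (b - 1) * (stern_l b N + b ^ Suc N)"
    using stern_l_exact[OF assms, of N] stern_l_exact[OF assms, of "Suc N"]
    by (simp add: distrib_left add.commute)
  then show ?thesis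
    using assms by simp
qed

lemma stern_l_Suc_mult:
  assumes "2 \<le> b"
  shows "stern_l b (Suc N) = b * stern_l b N + 1"
proof (induction N)
  case 0
  then show ?case
    using assms by (simp add: stern_l_0 stern_l_Suc)
next
  case (Suc N)
  have "stern_l b (Suc (Suc N)) = b * (stern_l b N + b ^ Suc N) + 1"
    using stern_l_Suc[OF assms, of "Suc N"] Suc.IH by (simp add: distrib_left)
  then show ?case
    using stern_l_Suc[OF assms, of N] by simp
qed

lemma stern_l_eq_mult_diff:
  assumes "2 \<le> b"
  shows "stern_l b N = b * (stern_l b N - b ^ N) + 1"
proof (cases N)
  case 0
  then show ?thesis using stern_l_0[OF assms] by simp
next
  case (Suc M)
  then show ?thesis
    using stern_l_Suc[OF assms, of M] stern_l_Suc_mult[OF assms, of M] by simp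
qed

theorem mainTheorem3:
  fixes b N :: nat
  assumes "2 \<le> b"
  shows "(b + 1) ^ N = (\<Sum>n = stern_l b N - b ^ N + 1..stern_l b N. stern b n)"
proof -
  have "(\<Sum>n\<in>{stern_l b N - b ^ N<..stern_l b N}. stern b n) = (b + 1) ^ N"
  proof (induction N)
    case 0
    have "{0<..Suc 0} = {1}" by auto
    then show ?case
      using stern_l_0[OF assms] stern_1[OF assms] by simp
  next
    case (Suc N)
    define p where "p = stern_l b N - b ^ N"
    define q where "q = stern_l b N"
    have q: "q = b * p + 1"
      using stern_l_eq_mult_diff[OF assms, of N] by (simp add: p_def q_def)
    have "stern b (q + 1) = stern b (p + 1)"
      using stern_digit[OF assms, of "p + 1" 1] assms q by simp
    moreover have "p \<le> q"
      by (simp add: p_def q_def)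
    ultimately have "(\<Sum>n\<in>{b * p + 1<..b * q + 1}. stern b n) = (b + 1) * (\<Sum>n\<in>{p<..q}. stern b n)"
      using sum_stern_stretch[OF assms, of p q] by simp
    moreover have "stern_l b (Suc N) - b ^ Suc N = b * p + 1"
      using stern_l_Suc[OF assms, of N] q by (simp add: q_def)
    moreover have "stern_l b (Suc N) = b * q + 1"
      using stern_l_Suc_mult[OF assms, of N] by (simp add: q_def)
    ultimately show ?case
      using Suc.IH by (simp add: p_def q_def)
  qed
  then show ?thesis
    by (simp add: atLeastSucAtMost_greaterThanAtMost)
qed

end
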